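(* (i) Let $n$ be odd and $\frac{n+1}{2}\le p\le n-2$. Put $r=\sum_{i=0}^{p-\frac{n-1}{2}}\binom{n}{i}$ and $s=\binom{p}{p-\frac{n-1}{2}}$. Then $|C^p(\mathcal{I}_{r-s})|=2^{n-1}-(r-2s)$. (ii) Let $n$ be even and $\frac{n}{2}+1\le p\le n-2$. Put $r'=\sum_{i=0}^{p-\frac{n}{2}}\binom{n}{i}+\binom{n-1}{p-\frac{n}{2}}$ and $s'=\binom{p-1}{p-\frac{n}{2}}$. Then $|C^p(\mathcal{I}_{r'-s'})|=2^{n-1}-(r'-2s')$.
   Context: $[n]=\{1,\dots,n\}$ and $2^{[n]}$ is its power set. The simplicial ordering on $2^{[n]}$: for distinct $x,y\in 2^{[n]}$, $x<y$ if either $|x|<|y|$, or $|x|=|y|$ and $\min(x\triangle y)\in x$. For $0\le m\le 2^n$, $\mathcal{I}_m$ denotes the set of the first $m$ elements of $2^{[n]}$ in the simplicial ordering. For $A\subseteq 2^{[n]}$, $C^p[A]=\{y\in 2^{[n]}: |x\triangle y|\le p \text{ for every } x\in A\}$ and $C^p(A)=C^p[A]\setminus A$. *)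

theory Defs
  imports Main
begin

text \<open>
  Only used for finite sets of natural numbers. The requirement \<open>x \<noteq> y\<close> is part of the
  definition, so the argument of \<open>Min\<close> is nonempty.
\<close>

definition simplicial_less :: "nat set \<Rightarrow> nat set \<Rightarrow> bool" where
  "simplicial_less x y \<longleftrightarrow>
     x \<noteq> y \<and> (card x < card y \<or> (card x = card y \<and> Min (sym_diff x y) \<in> x))"

text \<open>
  The first \<open>m\<close> elements of the power set of \<open>{1..n}\<close>: those with fewer than \<open>m\<close>
  predecessors. Meaningful for \<open>m \<le> 2 ^ n\<close>.
\<close>

definition initial_segment :: "nat \<Rightarrow> nat \<Rightarrow> nat set set" where
  "initial_segment n m =
     {x \<in> Pow {1..n}. card {y \<in> Pow {1..n}. simplicial_less y x} < m}"

definition closed_C :: "nat \<Rightarrow> nat \<Rightarrow> nat set set \<Rightarrow> nat set set" where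
  "closed_C n p A = {y \<in> Pow {1..n}. \<forall>x\<in>A. card (sym_diff x y) \<le> p}"

definition open_C :: "nat \<Rightarrow> nat \<Rightarrow> nat set set \<Rightarrow> nat set set" where
  "open_C n p A = closed_C n p A - A"

end

theory Submission
  imports Defs
begin

text \<open>
  Both segments consist of all sets with fewer than \<open>k\<close> elements together with the \<open>k\<close>-sets
  that contain \<open>{1..a}\<close> and meet \<open>{a<..b}\<close>, where \<open>a = 0\<close> for odd and \<open>a = 1\<close> for even \<open>n\<close>.
  A set \<open>y\<close> is within distance \<open>p\<close> of a set \<open>x\<close> iff the complement \<open>z\<close> of \<open>y\<close> has distance at
  least \<open>n - p\<close> from \<open>x\<close>. Demanding this for all \<open>x\<close> in the segment means, with
  \<open>t = n - p + k - 1\<close>, that \<open>|z| > t\<close>, or that \<open>|z| = t\<close> and \<open>z\<close> does not both contain \<open>{1..a}\<close>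
  and meet \<open>{a<..b}\<close>. The sets \<open>z\<close> with \<open>|z| > t\<close>, or with \<open>|z| = t\<close> and \<open>{1..a} \<not>\<subseteq> z\<close>, form
  exactly half of the power set, being exchanged with the remaining ones by complementation;
  what is left over are the \<open>t\<close>-sets that contain \<open>{1..a}\<close> and avoid \<open>{a<..b}\<close>.
\<close>

section \<open>Initial segments of the simplicial ordering\<close>

lemma simplicial_less_asym:
  assumes "finite x" "finite y" "simplicial_less x y"
  shows "\<not> simplicial_less y x"
proof
  assume "simplicial_less y x"
  with assms(3) have "x \<noteq> y" "Min (sym_diff x y) \<in> x" "Min (sym_diff y x) \<in> y"
    unfolding simplicial_less_def by auto
  moreover have "sym_diff y x = sym_diff x y"
    by blast
  moreover from \<open>x \<noteq> y\<close> have "Min (sym_diff x y) \<in> sym_diff x y"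
    using assms(1,2) by (intro Min_in) auto
  ultimately show False
    by auto
qed

text \<open>By asymmetry the predecessors of a member of \<open>S\<close> lie in \<open>S\<close>,
  and they omit the member itself, so there are fewer than \<open>card S\<close>; a set outside
  \<open>S\<close> has all of \<open>S\<close> among its predecessors.\<close>

lemma initial_segment_card_eq:
  assumes "S \<subseteq> Pow {1..n}"
    and less: "\<And>x y. x \<in> S \<Longrightarrow> y \<in> Pow {1..n} - S \<Longrightarrow> simplicial_less x y"
  shows "initial_segment n (card S) = S"
proof -
  have fin: "finite S"
    using assms(1) finite_subset by blast
  have in_S: "card {y \<in> Pow {1..n}. simplicial_less y x} < card S" if "x \<in> S" for x
  proof (rule psubset_card_mono[OF fin])
    have "y \<in> S" if y: "y \<subseteq> {1..n}" "simplicial_less y x" for y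
    proof (rule ccontr)
      assume "y \<notin> S"
      with less \<open>x \<in> S\<close> y have "simplicial_less x y"
        by blast
      moreover have "finite x" "finite y"
        using assms(1) \<open>x \<in> S\<close> y(1) finite_subset[of _ "{1..n}"] by blast+
      ultimately show False
        using simplicial_less_asym y(2) by blast
    qed
    moreover have "\<not> simplicial_less x x"
      by (simp add: simplicial_less_def)
    ultimately show "{y \<in> Pow {1..n}. simplicial_less y x} \<subset> S"
      using that by blast
  qed
  have notin_S: "card S \<le> card {y \<in> Pow {1..n}. simplicial_less y x}"
    if "x \<in> Pow {1..n} - S" for x
    using assms that by (intro card_mono) auto
  show ?thesis
    unfolding initial_segment_def using in_S notin_S assms(1)
    by (auto simp: not_less[symmetric])
qed

definition star_segment :: "nat \<Rightarrow> nat \<Rightarrow> nat \<Rightarrow> nat \<Rightarrow> nat set set" where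
  "star_segment n k a b = {x \<in> Pow {1..n}.
     card x < k \<or> card x = k \<and> {1..a} \<subseteq> x \<and> x \<inter> {a<..b} \<noteq> {}}"

text \<open>Within layer \<open>k\<close>, the least element \<open>d\<close> of the symmetric
  difference cannot lie in \<open>y\<close> alone: it would exceed \<open>a\<close>, so
  \<open>y\<close> would contain \<open>{1..a}\<close> and hence avoid \<open>{a<..b}\<close>; then
  \<open>b < d\<close>, and \<open>y\<close> would share the point of \<open>x\<close> in
  \<open>{a<..b}\<close>.\<close>

lemma simplicial_less_star_segment:
  assumes x: "x \<in> star_segment n k a b" and y: "y \<in> Pow {1..n} - star_segment n k a b"
  shows "simplicial_less x y"
proof (cases "card x = k \<and> card y = k")
  case False
  with assms show ?thesis
    by (auto simp: star_segment_def simplicial_less_def)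
next
  case True
  with x obtain e where ax: "{1..a} \<subseteq> x" and e: "e \<in> x" "a < e" "e \<le> b"
    by (auto simp: star_segment_def)
  have fin: "finite (sym_diff x y)"
    using assms finite_subset[of _ "{1..n}"] by (auto simp: star_segment_def)
  from assms have "x \<noteq> y"
    by auto
  define d where "d = Min (sym_diff x y)"
  have d: "d \<in> sym_diff x y"
    unfolding d_def using fin \<open>x \<noteq> y\<close> by (intro Min_in) auto
  have agree: "i \<in> x \<longleftrightarrow> i \<in> y" if "i < d" for i
    using that fin Min_le[of "sym_diff x y" i] unfolding d_def by (meson DiffI UnCI leD)
  have "d \<in> x"
  proof (rule ccontr)
    assume "d \<notin> x"
    with d have "d \<in> y"
      by blast
    \<comment> \<open>Being outside \<open>{1..a}\<close> gives \<open>a < d\<close> only once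
      \<open>d = 0\<close> is excluded.\<close>
    moreover have "1 \<le> d"
      using \<open>d \<in> y\<close> y by auto
    ultimately have "a < d"
      using ax \<open>d \<notin> x\<close> by (auto simp: subset_iff not_le[symmetric])
    with ax agree have "{1..a} \<subseteq> y"
      by auto
    with y True have "y \<inter> {a<..b} = {}"
      by (auto simp: star_segment_def)
    with \<open>d \<in> y\<close> \<open>a < d\<close> have "b < d"
      by auto
    with e agree have "e \<in> y"
      by simp
    with e \<open>y \<inter> {a<..b} = {}\<close> show False
      by auto
  qed
  with True \<open>x \<noteq> y\<close> show ?thesis
    by (simp add: simplicial_less_def d_def)
qed

lemma initial_segment_star_segment:
  "initial_segment n (card (star_segment n k a b)) = star_segment n k a b"
proof (rule initial_segment_card_eq[OF _ simplicial_less_star_segment])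
  show "star_segment n k a b \<subseteq> Pow {1..n}"
    by (auto simp: star_segment_def)
qed

section \<open>Cardinality of the segments\<close>

lemma card_subsets_containing_avoiding:
  assumes "finite U" "A \<subseteq> U" "B \<subseteq> U" "A \<inter> B = {}" "card A \<le> k"
  shows "card {x. x \<subseteq> U \<and> card x = k \<and> A \<subseteq> x \<and> x \<inter> B = {}} =
    (card U - card (A \<union> B)) choose (k - card A)"
proof -
  have fin: "finite A" "finite B" "\<And>x. x \<subseteq> U \<Longrightarrow> finite x"
    using assms finite_subset by blast+
  have "bij_betw (\<lambda>y. A \<union> y) {y. y \<subseteq> U - (A \<union> B) \<and> card y = k - card A}
      {x. x \<subseteq> U \<and> card x = k \<and> A \<subseteq> x \<and> x \<inter> B = {}}"
  proof (rule bij_betw_byWitness[where f' = "\<lambda>x. x - A"])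
    show "(\<lambda>y. A \<union> y) ` {y. y \<subseteq> U - (A \<union> B) \<and> card y = k - card A}
        \<subseteq> {x. x \<subseteq> U \<and> card x = k \<and> A \<subseteq> x \<and> x \<inter> B = {}}"
    proof (intro subsetI, elim imageE, clarify)
      fix y assume y: "y \<subseteq> U - (A \<union> B)" "card y = k - card A"
      then have "A \<inter> y = {}" "finite y"
        using fin(3) by blast+
      then have "card (A \<union> y) = k"
        using y(2) assms(5) fin by (simp add: card_Un_disjoint)
      with y(1) assms show "A \<union> y \<subseteq> U \<and> card (A \<union> y) = k \<and> A \<subseteq> A \<union> y \<and> (A \<union> y) \<inter> B = {}"
        by blast
    qed
    show "(\<lambda>x. x - A) ` {x. x \<subseteq> U \<and> card x = k \<and> A \<subseteq> x \<and> x \<inter> B = {}}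
        \<subseteq> {y. y \<subseteq> U - (A \<union> B) \<and> card y = k - card A}"
      using fin by (auto simp: card_Diff_subset)
  qed auto
  then have "card {x. x \<subseteq> U \<and> card x = k \<and> A \<subseteq> x \<and> x \<inter> B = {}} =
      card {y. y \<subseteq> U - (A \<union> B) \<and> card y = k - card A}"
    by (simp add: bij_betw_same_card)
  also have "\<dots> = (card U - card (A \<union> B)) choose (k - card A)"
    using assms fin by (simp add: n_subsets card_Diff_subset)
  finally show ?thesis .
qed

text \<open>Serves three counts: the \<open>k\<close>-sets containing \<open>{1..a}\<close> that a
  segment leaves out, all \<open>k\<close>-sets containing \<open>{1..a}\<close> (with
  \<open>b = a\<close>), and the surplus sets in layer \<open>t\<close>.\<close>

lemma card_layer:
  assumes "a \<le> b" "b \<le> n" "a \<le> k"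
  shows "card {x \<in> Pow {1..n}. card x = k \<and> {1..a} \<subseteq> x \<and> x \<inter> {a<..b} = {}} =
    (n - b) choose (k - a)"
proof -
  have "{1..a} \<union> {a<..b} = {1..b}"
    using assms by auto
  then show ?thesis
    using card_subsets_containing_avoiding[of "{1..n}" "{1..a}" "{a<..b}" k] assms by force
qed

lemma card_subsets_less:
  assumes "finite U"
  shows "card {x \<in> Pow U. card x < k} = (\<Sum>i<k. card U choose i)"
proof -
  have "{x \<in> Pow U. card x < k} = (\<Union>i<k. {x. x \<subseteq> U \<and> card x = i})"
    by auto
  also have "card \<dots> = (\<Sum>i<k. card {x. x \<subseteq> U \<and> card x = i})"
    using assms by (intro card_UN_disjoint) auto
  finally show ?thesis
    using assms by (simp add: n_subsets)
qed

text \<open>The \<open>k\<close>-sets that contain \<open>{1..a}\<close> but avoid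
  \<open>{a<..b}\<close> complete the segment to all smaller sets and all \<open>k\<close>-sets
  containing \<open>{1..a}\<close>. The additive form avoids truncated subtraction.\<close>

lemma card_star_segment:
  assumes "a \<le> b" "b \<le> n" "a \<le> k"
  shows "card (star_segment n k a b) + ((n - b) choose (k - a)) =
    (\<Sum>i<k. n choose i) + ((n - a) choose (k - a))"
proof -
  let ?D = "{x \<in> Pow {1..n}. card x = k \<and> {1..a} \<subseteq> x \<and> x \<inter> {a<..b} = {}}"
  let ?L = "{x \<in> Pow {1..n}. card x < k}"
  let ?M = "{x \<in> Pow {1..n}. card x = k \<and> {1..a} \<subseteq> x}"
  have "card (star_segment n k a b) + card ?D = card (star_segment n k a b \<union> ?D)"
    by (rule card_Un_disjoint[symmetric]) (auto simp: star_segment_def)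
  also have "star_segment n k a b \<union> ?D = ?L \<union> ?M"
    by (auto simp: star_segment_def)
  also have "card \<dots> = card ?L + card ?M"
    by (rule card_Un_disjoint) auto
  finally show ?thesis
    using assms card_layer[of a b n k] card_layer[of a a n k] card_subsets_less[of "{1..n}" k]
    by simp
qed

section \<open>Distances, complements and the sets far from a segment\<close>

lemma card_sym_diff:
  assumes "finite x" "finite z"
  shows "card (sym_diff x z) + 2 * card (x \<inter> z) = card x + card z"
proof -
  have "card (sym_diff x z) = card (x - z) + card (z - x)"
    using assms by (intro card_Un_disjoint) auto
  moreover have "card x = card (x - z) + card (x \<inter> z)" "card z = card (z - x) + card (x \<inter> z)"
    using assms by (metis add.commute card_Int_Diff inf_commute)+
  ultimately show ?thesis
    by simp
qed

text \<open>Each point of \<open>U\<close> lies in exactly one of \<open>y\<close> and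
  \<open>U - y\<close>, hence in exactly one of the two symmetric differences.\<close>

lemma card_sym_diff_compl:
  assumes "finite U" "x \<subseteq> U" "y \<subseteq> U"
  shows "card (sym_diff x y) + card (sym_diff x (U - y)) = card U"
proof -
  have "card (sym_diff x y \<union> sym_diff x (U - y)) =
      card (sym_diff x y) + card (sym_diff x (U - y))"
    using assms finite_subset[of _ U] by (intro card_Un_disjoint) auto
  moreover have "sym_diff x y \<union> sym_diff x (U - y) = U"
    using assms by auto
  ultimately show ?thesis
    by simp
qed

lemma closed_C_iff_compl:
  assumes "p \<le> n" "S \<subseteq> Pow {1..n}"
  shows "y \<in> closed_C n p S \<longleftrightarrow>
    y \<subseteq> {1..n} \<and> (\<forall>x\<in>S. n - p \<le> card (sym_diff x ({1..n} - y)))"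
proof -
  have "card (sym_diff x y) \<le> p \<longleftrightarrow> n - p \<le> card (sym_diff x ({1..n} - y))"
    if "x \<in> S" "y \<subseteq> {1..n}" for x
    using card_sym_diff_compl[of "{1..n}" x y] that assms by auto
  then show ?thesis
    unfolding closed_C_def by blast
qed

text \<open>The rule for layer \<open>t\<close> is void for \<open>a = 0\<close>, since
  \<open>{1..0}\<close> is empty; for \<open>a = 1\<close> it selects the sets without 1, as needed
  to halve the middle layer when \<open>n\<close> is even.\<close>

definition big_sets :: "nat \<Rightarrow> nat \<Rightarrow> nat \<Rightarrow> nat set set" where
  "big_sets n t a = {z \<in> Pow {1..n}. t < card z \<or> card z = t \<and> \<not> {1..a} \<subseteq> z}"

text \<open>A bad \<open>z\<close> is exposed by a subset of \<open>z\<close> in the segment. For a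
  good \<open>z\<close>, the bound \<open>card z - card x\<close> on the distance suffices unless
  \<open>card x = k\<close> and \<open>card z = t\<close>.\<close>

lemma far_from_star_segment_iff:
  assumes "a < k" "k \<le> t" and z: "z \<subseteq> {1..n}"
  shows "(\<forall>x \<in> star_segment n k a b. t + 1 - k \<le> card (sym_diff x z)) \<longleftrightarrow>
    z \<in> big_sets n t a \<union> {x \<in> Pow {1..n}. card x = t \<and> {1..a} \<subseteq> x \<and> x \<inter> {a<..b} = {}}"
    (is "?far \<longleftrightarrow> ?big")
proof
  have fin: "finite z"
    using z finite_subset by blast
  have dist_sub: "card (sym_diff x z) = card z - card x" if "x \<subseteq> z" for x
    using card_sym_diff[OF finite_subset[OF that fin] fin] that by (simp add: Int_absorb2)
  show ?big if far: ?far
  proof -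
    have "t \<le> card z"
    proof (rule ccontr)
      assume "\<not> t \<le> card z"
      \<comment> \<open>The cap \<open>card z\<close> covers a \<open>z\<close> with fewer than
        \<open>k - 1\<close> elements; then \<open>x = z\<close> has distance 0, still below
        \<open>t + 1 - k\<close> because \<open>k \<le> t\<close>.\<close>
      obtain x where x: "x \<subseteq> z" "card x = min (k - 1) (card z)"
        by (meson min.cobounded2 obtain_subset_with_card_n)
      then have "x \<in> star_segment n k a b"
        using z assms(1) by (auto simp: star_segment_def)
      with far have "t + 1 - k \<le> card (sym_diff x z)"
        by blast
      with x dist_sub \<open>\<not> t \<le> card z\<close> assms show False
        by auto
    qed
    moreover have False if "card z = t" "{1..a} \<subseteq> z" "z \<inter> {a<..b} \<noteq> {}"
    proof -
      from that(3) obtain e where e: "e \<in> z" "a < e" "e \<le> b"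
        by auto
      \<comment> \<open>Here \<open>a < k\<close> leaves room for \<open>e\<close>, so some
        \<open>k\<close>-subset of \<open>z\<close> is in the segment, at distance only
        \<open>t - k\<close>.\<close>
      then have "card (insert e {1..a}) \<le> k" "k \<le> card z" "insert e {1..a} \<subseteq> z"
        using that assms by auto
      from exists_subset_between[OF this fin]
      obtain x where x: "insert e {1..a} \<subseteq> x" "x \<subseteq> z" "card x = k"
        by blast
      then have "x \<in> star_segment n k a b"
        using z e by (auto simp: star_segment_def)
      with far have "t + 1 - k \<le> card (sym_diff x z)"
        by blast
      with x dist_sub that(1) assms show False
        by auto
    qed
    ultimately show ?big
      using z by (force simp: big_sets_def)
  qed
  show ?far if big: ?big
  proof
    fix x assume x: "x \<in> star_segment n k a b"
    then have fx: "finite x"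
      using finite_subset[of _ "{1..n}"] by (auto simp: star_segment_def)
    note dist = card_sym_diff[OF fx fin]
    have le: "card (x \<inter> z) \<le> card x"
      using fx by (simp add: card_mono)
    show "t + 1 - k \<le> card (sym_diff x z)"
    proof (cases "card x < k \<or> t < card z")
      case True
      with x big have "card x + (t + 1 - k) \<le> card z"
        using assms by (auto simp: star_segment_def big_sets_def)
      with dist le show ?thesis
        by linarith
    next
      case False
      with x big have *: "card x = k" "card z = t" "{1..a} \<subseteq> x" "x \<inter> {a<..b} \<noteq> {}"
        by (auto simp: star_segment_def big_sets_def)
      \<comment> \<open>Otherwise \<open>z\<close> would inherit from \<open>x\<close> both
        \<open>{1..a}\<close> and a point of \<open>{a<..b}\<close>.\<close>
      with False big have "\<not> x \<subseteq> z"
        by (auto simp: big_sets_def)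
      then have "x \<inter> z \<subset> x"
        by blast
      then have "card (x \<inter> z) < k"
        using psubset_card_mono[OF fx] *(1) by simp
      with dist * show ?thesis
        by linarith
    qed
  qed
qed

section \<open>Complementation and the size of \<open>open_C\<close>\<close>

lemma card_compl_image:
  assumes "T \<subseteq> Pow U"
  shows "card {y. y \<subseteq> U \<and> U - y \<in> T} = card T"
proof (rule bij_betw_same_card[of "\<lambda>y. U - y"], rule bij_betw_byWitness[where f' = "\<lambda>y. U - y"])
qed (use assms in \<open>auto simp: double_diff\<close>)

lemma card_half_Pow:
  assumes "finite U" "T \<subseteq> Pow U" and compl: "\<And>z. z \<subseteq> U \<Longrightarrow> U - z \<in> T \<longleftrightarrow> z \<notin> T"
  shows "2 * card T = 2 ^ card U"
proof -
  have "{y. y \<subseteq> U \<and> U - y \<in> T} = Pow U - T"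
    using compl by auto
  with card_compl_image[OF assms(2)] have "card (Pow U - T) = card T"
    by simp
  moreover have "card (Pow U - T) = 2 ^ card U - card T" "card T \<le> 2 ^ card U"
    using assms(1,2) card_mono[OF _ assms(2)] finite_subset[OF assms(2)]
    by (auto simp: card_Diff_subset card_Pow)
  ultimately show ?thesis
    using assms(1) by (simp add: card_Pow)
qed

lemma card_open_C_star_segment:
  assumes "a < k" "k \<le> t" "a \<le> b" "b \<le> n" "k + t < n" "p \<le> n" "n + k = p + t + 1"
    and half: "\<And>z. z \<subseteq> {1..n} \<Longrightarrow> {1..n} - z \<in> big_sets n t a \<longleftrightarrow> z \<notin> big_sets n t a"
  shows "int (card (open_C n p (star_segment n k a b))) =
    2 ^ (n - 1) + int ((n - b) choose (t - a)) - int (card (star_segment n k a b))"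
proof -
  let ?S = "star_segment n k a b" and ?T = "big_sets n t a"
  let ?E = "{x \<in> Pow {1..n}. card x = t \<and> {1..a} \<subseteq> x \<and> x \<inter> {a<..b} = {}}"
  have S: "?S \<subseteq> Pow {1..n}" and T: "?T \<subseteq> Pow {1..n}"
    by (auto simp: star_segment_def big_sets_def)
  have "n - p = t + 1 - k"
    using assms by simp
  with closed_C_iff_compl[OF \<open>p \<le> n\<close> S] far_from_star_segment_iff[OF assms(1,2)]
  have C: "closed_C n p ?S = {y. y \<subseteq> {1..n} \<and> {1..n} - y \<in> ?T \<union> ?E}"
    by (metis (no_types, lifting) Collect_cong Collect_mem_eq Diff_subset)
  have "card (closed_C n p ?S) = card (?T \<union> ?E)"
    unfolding C by (rule card_compl_image) (use T in blast)
  also have "\<dots> = card ?T + card ?E"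
    using T by (intro card_Un_disjoint) (auto simp: big_sets_def intro: finite_subset)
  also have "card ?E = (n - b) choose (t - a)"
    using assms by (intro card_layer) auto
  finally have card_C: "card (closed_C n p ?S) = card ?T + ((n - b) choose (t - a))" .
  have "2 * card ?T = 2 ^ n"
    using card_half_Pow[OF _ T half] by simp
  then have card_T: "card ?T = 2 ^ (n - 1)"
    using assms by (cases n) auto
  \<comment> \<open>The complement of a member has at least \<open>n - k > t\<close> elements. Thus
    removing the segment subtracts its full size.\<close>
  have sub: "?S \<subseteq> closed_C n p ?S"
  proof
    fix y assume y: "y \<in> ?S"
    then have "y \<subseteq> {1..n}" "card y \<le> k"
      by (auto simp: star_segment_def)
    moreover from this have "card ({1..n} - y) = n - card y"
      by (simp add: card_Diff_subset finite_subset)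
    ultimately show "y \<in> closed_C n p ?S"
      unfolding C using assms by (auto simp: big_sets_def)
  qed
  have "finite (closed_C n p ?S)"
    by (simp add: closed_C_def)
  then have "card (open_C n p ?S) = card (closed_C n p ?S) - card ?S"
    "card ?S \<le> card (closed_C n p ?S)"
    unfolding open_C_def using sub by (auto intro: card_Diff_subset card_mono finite_subset)
  with card_C card_T show ?thesis
    by simp
qed

section \<open>The odd and the even case\<close>

lemma compl_big_sets_odd:
  assumes "n = 2 * m + 1" "z \<subseteq> {1..n}"
  shows "{1..n} - z \<in> big_sets n m 0 \<longleftrightarrow> z \<notin> big_sets n m 0"
proof -
  have "card ({1..n} - z) + card z = n"
    using assms(2) card_mono[of "{1..n}" z] by (simp add: card_Diff_subset finite_subset)
  with assms show ?thesis
    by (auto simp: big_sets_def)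
qed

text \<open>If neither \<open>z\<close> nor its complement has more than \<open>m\<close> elements,
  both have \<open>m\<close>, and exactly one of them lacks 1; \<open>0 < m\<close> puts 1 into the
  ground set.\<close>

lemma compl_big_sets_even:
  assumes "n = 2 * m" "0 < m" "z \<subseteq> {1..n}"
  shows "{1..n} - z \<in> big_sets n m 1 \<longleftrightarrow> z \<notin> big_sets n m 1"
proof -
  have "card ({1..n} - z) + card z = n"
    using assms(3) card_mono[of "{1..n}" z] by (simp add: card_Diff_subset finite_subset)
  with assms show ?thesis
    by (auto simp: big_sets_def)
qed

lemma card_open_C_odd:
  fixes n p m :: nat
  assumes n: "n = 2 * m + 1" and p: "m + 1 \<le> p" "p + 2 \<le> n"
  defines "r \<equiv> \<Sum>i = 0..p - m. n choose i" and "s \<equiv> p choose (p - m)"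
  shows "int (card (open_C n p (initial_segment n (r - s)))) = 2 ^ (n - 1) - (int r - 2 * int s)"
proof -
  \<comment> \<open>With \<open>b = n - p\<close> there are \<open>p\<close> elements beyond
    \<open>b\<close>, so \<open>s\<close> counts the sets of layer \<open>p - m\<close> that the
    segment omits.\<close>
  let ?S = "star_segment n (p - m) 0 (n - p)"
  have "card ?S + s = r"
    using card_star_segment[of 0 "n - p" n "p - m"] p
    by (simp add: r_def s_def atLeast0AtMost lessThan_Suc_atMost[symmetric])
  moreover from this have "r - s = card ?S"
    by simp
  then have "initial_segment n (r - s) = ?S"
    by (simp only: initial_segment_star_segment)
  \<comment> \<open>By symmetry the surplus in layer \<open>m\<close> is \<open>s\<close> as well,
    so the size is \<open>2 ^ (n - 1) + s - (r - s)\<close>; this is the source of the factor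
    2.\<close>
  moreover have "p choose m = s"
    unfolding s_def using p by (intro binomial_symmetric) simp
  ultimately show ?thesis
    using card_open_C_star_segment[of 0 "p - m" m "n - p" n p] compl_big_sets_odd[OF n] n p
    by auto
qed

lemma card_open_C_even:
  fixes n p m :: nat
  assumes n: "n = 2 * m" and p: "m + 1 \<le> p" "p + 2 \<le> n"
  defines "r \<equiv> (\<Sum>i = 0..p - m. n choose i) + ((n - 1) choose (p - m))"
    and "s \<equiv> (p - 1) choose (p - m)"
  shows "int (card (open_C n p (initial_segment n (r - s)))) = 2 ^ (n - 1) - (int r - 2 * int s)"
proof -
  \<comment> \<open>Forcing the element 1 shifts \<open>k\<close> and \<open>b\<close> by one: an
    omitted set of layer \<open>k\<close> containing 1 has its other \<open>p - m\<close> elements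
    among the \<open>p - 1\<close> beyond \<open>b\<close>.\<close>
  let ?S = "star_segment n (p - m + 1) 1 (n - p + 1)"
  have b: "n - (n - p + 1) = p - 1"
    using p by simp
  have "card ?S + s = r"
    using card_star_segment[of 1 "n - p + 1" n "p - m + 1"] p b
    by (simp add: r_def s_def atLeast0AtMost lessThan_Suc_atMost)
  moreover from this have "r - s = card ?S"
    by simp
  then have "initial_segment n (r - s) = ?S"
    by (simp only: initial_segment_star_segment)
  \<comment> \<open>The surplus sets of layer \<open>m\<close> contain 1 too, leaving
    \<open>m - 1\<close> of the \<open>p - 1\<close> elements to choose.\<close>
  moreover have "(p - 1) choose (m - 1) = s"
    unfolding s_def using n p by (subst binomial_symmetric) auto
  ultimately show ?thesis
    using card_open_C_star_segment[of 1 "p - m + 1" m "n - p + 1" n p] compl_big_sets_even[OF n]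
      n p b
    by auto
qed

theorem theorem3p5:
  fixes n p :: nat
  shows
    "(odd n \<and> (n + 1) div 2 \<le> p \<and> p + 2 \<le> n \<longrightarrow>
        (let r = (\<Sum>i = 0..p - (n - 1) div 2. n choose i);
             s = p choose (p - (n - 1) div 2)
         in int (card (open_C n p (initial_segment n (r - s))))
              = 2 ^ (n - 1) - (int r - 2 * int s)))
     \<and>
     (even n \<and> n div 2 + 1 \<le> p \<and> p + 2 \<le> n \<longrightarrow>
        (let r' = (\<Sum>i = 0..p - n div 2. n choose i) + ((n - 1) choose (p - n div 2));
             s' = (p - 1) choose (p - n div 2)
         in int (card (open_C n p (initial_segment n (r' - s'))))
              = 2 ^ (n - 1) - (int r' - 2 * int s')))"
proof (intro conjI impI)
  assume *: "odd n \<and> (n + 1) div 2 \<le> p \<and> p + 2 \<le> n"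
  then obtain m where "n = 2 * m + 1"
    by (auto elim: oddE)
  with * card_open_C_odd[of n m p]
  show "let r = (\<Sum>i = 0..p - (n - 1) div 2. n choose i);
             s = p choose (p - (n - 1) div 2)
         in int (card (open_C n p (initial_segment n (r - s))))
              = 2 ^ (n - 1) - (int r - 2 * int s)"
    by (simp add: Let_def)
next
  assume *: "even n \<and> n div 2 + 1 \<le> p \<and> p + 2 \<le> n"
  with card_open_C_even[of n "n div 2" p]
  show "let r' = (\<Sum>i = 0..p - n div 2. n choose i) + ((n - 1) choose (p - n div 2));
             s' = (p - 1) choose (p - n div 2)
         in int (card (open_C n p (initial_segment n (r' - s'))))
              = 2 ^ (n - 1) - (int r' - 2 * int s')"
    by (simp add: Let_def)
qed

end
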